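(* Let $X$ be an order complete vector lattice. (i) If $X$ is uo-complete, then $X$ is universally complete. (ii) Conversely, if $X$ is universally complete and, in addition, has the countable sup property, then $X$ is uo-complete.
   Context: All vector lattices are assumed to be Archimedean. A vector lattice is order complete if every order bounded (nonempty) subset has a supremum. It is laterally complete if every collection of mutually disjoint positive vectors admits a supremum, and universally complete if it is both order complete and laterally complete. It has the countable sup property if any subset having a supremum admits an at most countable subset having the same supremum. A net $(x_\alpha)_{\alpha\in\Gamma}$ in a vector lattice $X$ converges in order to $x\in X$, written $x_\alpha\xrightarrow{\mathrm{o}}x$, if there is another net $(a_\gamma)_{\gamma\in\Lambda}$ in $X$ (possibly with a different index set) with $a_\gamma\downarrow 0$ such that for every $\gamma\in\Lambda$ there exists $\alpha_0\in\Gamma$ with $|x_\alpha-x|\le a_\gamma$ for all $\alpha\ge\alpha_0$. The net uo-converges to $x$ if $|x_\alpha-x|\wedge y\xrightarrow{\mathrm{o}}0$ for every $y\in X_+$. The net is uo-Cauchy if the doubly indexed net $(x_\alpha-x_{\alpha'})_{(\alpha,\alpha')\in\Gamma\times\Gamma}$ (with $\Gamma\times\Gamma$ directed coordinatewise) uo-converges to $0$. $X$ is uo-complete if every uo-Cauchy net in $X$ is uo-convergent to some element of $X$. *)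

theory Defs
  imports
    "HOL-Library.Lub_Glb"
    "HOL-Library.Lattice_Algebras"
    "HOL-Library.Countable_Set"
begin

text \<open>The class \<open>lattice_ab_group_add_abs\<close> contributes the lattice operations and the
  lattice modulus \<open>\<bar>x\<bar> = sup x (- x)\<close>. The carrier of a vector lattice is the whole type.\<close>

class vector_lattice = ordered_real_vector + lattice_ab_group_add_abs

class archimedean_vector_lattice = vector_lattice +
  assumes archimedean_vl: "0 \<le> x \<Longrightarrow> (\<And>n::nat. real n *\<^sub>R x \<le> y) \<Longrightarrow> x = 0"


section \<open>Completeness properties\<close>

definition order_complete :: "'a::archimedean_vector_lattice itself \<Rightarrow> bool" where
  "order_complete TYPE('a) \<longleftrightarrow>
     (\<forall>S::'a set. S \<noteq> {} \<longrightarrow> bdd_above S \<longrightarrow> bdd_below S \<longrightarrow> (\<exists>s. isLub UNIV S s))"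

definition vl_disjoint :: "'a::vector_lattice \<Rightarrow> 'a \<Rightarrow> bool" where
  "vl_disjoint x y \<longleftrightarrow> inf \<bar>x\<bar> \<bar>y\<bar> = 0"

text \<open>\<open>S \<noteq> {}\<close> is needed because the empty set has no supremum in a nonzero vector lattice.\<close>

definition laterally_complete :: "'a::archimedean_vector_lattice itself \<Rightarrow> bool" where
  "laterally_complete TYPE('a) \<longleftrightarrow>
     (\<forall>S::'a set. S \<noteq> {} \<longrightarrow> (\<forall>x\<in>S. 0 \<le> x) \<longrightarrow> pairwise vl_disjoint S \<longrightarrow> (\<exists>s. isLub UNIV S s))"

definition universally_complete :: "'a::archimedean_vector_lattice itself \<Rightarrow> bool" where
  "universally_complete TYPE('a) \<longleftrightarrow> order_complete TYPE('a) \<and> laterally_complete TYPE('a)"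

definition countable_sup_property :: "'a::archimedean_vector_lattice itself \<Rightarrow> bool" where
  "countable_sup_property TYPE('a) \<longleftrightarrow>
     (\<forall>(S::'a set) s. isLub UNIV S s \<longrightarrow> (\<exists>C\<subseteq>S. countable C \<and> isLub UNIV C s))"


section \<open>Nets and order convergence\<close>

text \<open>A net is a function \<open>x\<close> on a nonempty set \<open>I\<close> directed by a preorder \<open>le\<close>.\<close>

definition directed_set :: "'i set \<Rightarrow> ('i \<Rightarrow> 'i \<Rightarrow> bool) \<Rightarrow> bool" where
  "directed_set I le \<longleftrightarrow> I \<noteq> {} \<and> reflp_on I le \<and> transp_on I le \<and>
     (\<forall>\<alpha>\<in>I. \<forall>\<beta>\<in>I. \<exists>\<gamma>\<in>I. le \<alpha> \<gamma> \<and> le \<beta> \<gamma>)"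

definition decreases_to_zero ::
    "'j set \<Rightarrow> ('j \<Rightarrow> 'j \<Rightarrow> bool) \<Rightarrow> ('j \<Rightarrow> 'a::vector_lattice) \<Rightarrow> bool" where
  "decreases_to_zero J le a \<longleftrightarrow>
     (\<forall>\<gamma>\<in>J. \<forall>\<delta>\<in>J. le \<gamma> \<delta> \<longrightarrow> a \<delta> \<le> a \<gamma>) \<and> isGlb UNIV (a ` J) 0"

definition order_dominated ::
    "'i set \<Rightarrow> ('i \<Rightarrow> 'i \<Rightarrow> bool) \<Rightarrow> ('i \<Rightarrow> 'a::vector_lattice) \<Rightarrow> 'a \<Rightarrow>
     'j set \<Rightarrow> ('j \<Rightarrow> 'a) \<Rightarrow> bool" where
  "order_dominated I le x l J a \<longleftrightarrow>
     (\<forall>\<gamma>\<in>J. \<exists>\<alpha>0\<in>I. \<forall>\<alpha>\<in>I. le \<alpha>0 \<alpha> \<longrightarrow> \<bar>x \<alpha> - l\<bar> \<le> a \<gamma>)"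

text \<open>HOL cannot quantify over the type of the index set of the dominating net, so that type is
  taken to be \<open>'a\<close> itself. By \<open>order_convergesI\<close> below, a dominating net over any other
  index type yields one of this kind.\<close>

definition order_converges ::
    "'i set \<Rightarrow> ('i \<Rightarrow> 'i \<Rightarrow> bool) \<Rightarrow> ('i \<Rightarrow> 'a::vector_lattice) \<Rightarrow> 'a \<Rightarrow> bool" where
  "order_converges I le x l \<longleftrightarrow>
     (\<exists>(J::'a set) leJ a. directed_set J leJ \<and> decreases_to_zero J leJ a \<and>
        order_dominated I le x l J a)"

lemma order_convergesI:
  fixes x :: "'i \<Rightarrow> 'a::vector_lattice" and J :: "'j set"
  assumes J: "directed_set J leJ" and a: "decreases_to_zero J leJ a"
    and dom: "order_dominated I le x l J a"
  shows "order_converges I le x l"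
  unfolding order_converges_def
proof (intro exI conjI)
  show "directed_set (a ` J) (\<lambda>u v. v \<le> u)"
    unfolding directed_set_def
  proof (intro conjI)
    show "\<forall>u\<in>a ` J. \<forall>v\<in>a ` J. \<exists>w\<in>a ` J. w \<le> u \<and> w \<le> v"
    proof clarify
      fix p q assume pq: "p \<in> J" "q \<in> J"
      then obtain r where "r \<in> J" "leJ p r" "leJ q r"
        using J unfolding directed_set_def by blast
      with a pq have "a r \<le> a p" "a r \<le> a q" unfolding decreases_to_zero_def by blast+
      with \<open>r \<in> J\<close> show "\<exists>w\<in>a ` J. w \<le> a p \<and> w \<le> a q" by blast
    qed
  qed (use J in \<open>auto simp: directed_set_def reflp_on_def transp_on_def\<close>)
  show "decreases_to_zero (a ` J) (\<lambda>u v. v \<le> u) id"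
    using a by (auto simp: decreases_to_zero_def)
  show "order_dominated I le x l (a ` J) id"
    using dom by (auto simp: order_dominated_def)
qed

definition uo_converges ::
    "'i set \<Rightarrow> ('i \<Rightarrow> 'i \<Rightarrow> bool) \<Rightarrow> ('i \<Rightarrow> 'a::vector_lattice) \<Rightarrow> 'a \<Rightarrow> bool" where
  "uo_converges I le x l \<longleftrightarrow> (\<forall>y\<ge>0. order_converges I le (\<lambda>\<alpha>. inf \<bar>x \<alpha> - l\<bar> y) 0)"

text \<open>\<open>rel_prod le le\<close> is the coordinatewise preorder.\<close>

definition uo_Cauchy ::
    "'i set \<Rightarrow> ('i \<Rightarrow> 'i \<Rightarrow> bool) \<Rightarrow> ('i \<Rightarrow> 'a::vector_lattice) \<Rightarrow> bool" where
  "uo_Cauchy I le x \<longleftrightarrow> uo_converges (I \<times> I) (rel_prod le le) (\<lambda>(\<alpha>, \<alpha>'). x \<alpha> - x \<alpha>') 0"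

definition uo_complete_over ::
    "'i itself \<Rightarrow> 'a::archimedean_vector_lattice itself \<Rightarrow> bool" where
  "uo_complete_over TYPE('i) TYPE('a) \<longleftrightarrow>
     (\<forall>(I::'i set) le (x::'i \<Rightarrow> 'a). directed_set I le \<longrightarrow> uo_Cauchy I le x \<longrightarrow>
        (\<exists>l. uo_converges I le x l))"

text \<open>Uo-completeness concerns nets over arbitrary index sets, but HOL cannot quantify over index
  types. The index type \<open>'a set \<times> 'a\<close> suffices: by \<open>uo_complete_over_any\<close> below,
  uo-completeness for nets indexed by its directed subsets implies uo-completeness for nets over
  every other index type. The reason is that any net in \<open>'a\<close> can be reindexed by pairs \<open>(A, b)\<close> of a tail
  \<open>A\<close> of its values and an element \<open>b \<in> A\<close>.\<close>

definition uo_complete :: "'a::archimedean_vector_lattice itself \<Rightarrow> bool" where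
  "uo_complete TYPE('a) \<longleftrightarrow> uo_complete_over TYPE('a set \<times> 'a) TYPE('a)"


section \<open>Independence of the index type\<close>

text \<open>Every tail of \<open>x\<close> contains the values of some tail of \<open>y\<close>.\<close>

definition tail_finer ::
    "'i set \<Rightarrow> ('i \<Rightarrow> 'i \<Rightarrow> bool) \<Rightarrow> ('i \<Rightarrow> 'b) \<Rightarrow>
     'j set \<Rightarrow> ('j \<Rightarrow> 'j \<Rightarrow> bool) \<Rightarrow> ('j \<Rightarrow> 'b) \<Rightarrow> bool" where
  "tail_finer I le x J leJ y \<longleftrightarrow>
     (\<forall>\<alpha>0\<in>I. \<exists>\<beta>0\<in>J. \<forall>\<beta>\<in>J. leJ \<beta>0 \<beta> \<longrightarrow> (\<exists>\<alpha>\<in>I. le \<alpha>0 \<alpha> \<and> x \<alpha> = y \<beta>))"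

lemma order_converges_tail:
  assumes "order_converges I le x l" "tail_finer I le x J leJ y"
  shows "order_converges J leJ y l"
proof -
  have "order_dominated J leJ y l K a" if dom: "order_dominated I le x l K a" for K :: "'b set" and a
    unfolding order_dominated_def
  proof
    fix \<gamma> assume "\<gamma> \<in> K"
    then obtain \<alpha>0 where \<alpha>0: "\<alpha>0 \<in> I" "\<And>\<alpha>. \<alpha> \<in> I \<Longrightarrow> le \<alpha>0 \<alpha> \<Longrightarrow> \<bar>x \<alpha> - l\<bar> \<le> a \<gamma>"
      using dom unfolding order_dominated_def by blast
    then obtain \<beta>0 where \<beta>0: "\<beta>0 \<in> J"
      "\<And>\<beta>. \<beta> \<in> J \<Longrightarrow> leJ \<beta>0 \<beta> \<Longrightarrow> \<exists>\<alpha>\<in>I. le \<alpha>0 \<alpha> \<and> x \<alpha> = y \<beta>"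
      using assms(2) unfolding tail_finer_def by blast
    have "\<bar>y \<beta> - l\<bar> \<le> a \<gamma>" if "\<beta> \<in> J" "leJ \<beta>0 \<beta>" for \<beta>
      using \<beta>0(2)[OF that] \<alpha>0(2) by force
    with \<beta>0(1) show "\<exists>\<beta>0\<in>J. \<forall>\<beta>\<in>J. leJ \<beta>0 \<beta> \<longrightarrow> \<bar>y \<beta> - l\<bar> \<le> a \<gamma>" by blast
  qed
  then show ?thesis using assms(1) unfolding order_converges_def by blast
qed

lemma tail_finer_comp:
  "tail_finer I le x J leJ y \<Longrightarrow> tail_finer I le (\<lambda>\<alpha>. f (x \<alpha>)) J leJ (\<lambda>\<beta>. f (y \<beta>))"
  unfolding tail_finer_def by (rule ballI, drule (1) bspec, erule bexE, rule bexI) force+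

lemma uo_converges_tail:
  assumes "uo_converges I le x l" "tail_finer I le x J leJ y"
  shows "uo_converges J leJ y l"
  unfolding uo_converges_def
proof (intro allI impI)
  fix z :: 'b assume "0 \<le> z"
  with assms(1) have "order_converges I le (\<lambda>\<alpha>. inf \<bar>x \<alpha> - l\<bar> z) 0"
    unfolding uo_converges_def by blast
  then show "order_converges J leJ (\<lambda>\<alpha>. inf \<bar>y \<alpha> - l\<bar> z) 0"
    by (rule order_converges_tail[OF _ tail_finer_comp[OF assms(2), of "\<lambda>u. inf \<bar>u - l\<bar> z"]])
qed

lemma uo_Cauchy_tail:
  assumes "uo_Cauchy I le x" "tail_finer I le x J leJ y"
  shows "uo_Cauchy J leJ y"
proof -
  have "tail_finer (I \<times> I) (rel_prod le le) (\<lambda>(\<alpha>, \<alpha>'). x \<alpha> - x \<alpha>')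
          (J \<times> J) (rel_prod leJ leJ) (\<lambda>(\<alpha>, \<alpha>'). y \<alpha> - y \<alpha>')"
    unfolding tail_finer_def
  proof (clarify, goal_cases)
    case (1 p q)
    obtain p' where p': "p' \<in> J" "\<forall>\<beta>\<in>J. leJ p' \<beta> \<longrightarrow> (\<exists>\<alpha>\<in>I. le p \<alpha> \<and> x \<alpha> = y \<beta>)"
      using assms(2) 1(1) unfolding tail_finer_def by blast
    obtain q' where q': "q' \<in> J" "\<forall>\<beta>\<in>J. leJ q' \<beta> \<longrightarrow> (\<exists>\<alpha>\<in>I. le q \<alpha> \<and> x \<alpha> = y \<beta>)"
      using assms(2) 1(2) unfolding tail_finer_def by blast
    show ?case
    proof (rule bexI[of _ "(p', q')"], clarify)
      fix b c assume "b \<in> J" "c \<in> J" "rel_prod leJ leJ (p', q') (b, c)"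
      then have "leJ p' b" "leJ q' c" by auto
      obtain \<alpha> where "\<alpha> \<in> I" "le p \<alpha>" "x \<alpha> = y b"
        using p'(2) \<open>b \<in> J\<close> \<open>leJ p' b\<close> by blast
      moreover obtain \<alpha>' where "\<alpha>' \<in> I" "le q \<alpha>'" "x \<alpha>' = y c"
        using q'(2) \<open>c \<in> J\<close> \<open>leJ q' c\<close> by blast
      ultimately show "\<exists>r\<in>I \<times> I. rel_prod le le (p, q) r \<and> (case r of (\<alpha>, \<alpha>') \<Rightarrow> x \<alpha> - x \<alpha>') = y b - y c"
        by (intro bexI[of _ "(\<alpha>, \<alpha>')"]) auto
    qed (use p' q' in auto)
  qed
  with assms(1) show ?thesis
    unfolding uo_Cauchy_def by (rule uo_converges_tail)
qed

theorem uo_complete_over_any: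
  assumes "uo_complete TYPE('a::archimedean_vector_lattice)"
  shows "uo_complete_over TYPE('i) TYPE('a)"
  unfolding uo_complete_over_def
proof (intro allI impI)
  fix I :: "'i set" and le and x :: "'i \<Rightarrow> 'a"
  assume I: "directed_set I le" and C: "uo_Cauchy I le x"
  define T where "T p = x ` {\<alpha>\<in>I. le p \<alpha>}" for p
  define J where "J = {(A, b). \<exists>p\<in>I. A = T p \<and> b \<in> A}"
  define leJ :: "'a set \<times> 'a \<Rightarrow> 'a set \<times> 'a \<Rightarrow> bool" where "leJ = (\<lambda>r s. fst s \<subseteq> fst r)"
  have refl: "le p p" if "p \<in> I" for p
    using I that by (auto simp: directed_set_def reflp_on_def)
  have trans: "le p r" if "p \<in> I" "q \<in> I" "r \<in> I" "le p q" "le q r" for p q r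
    using I that unfolding directed_set_def transp_on_def by blast
  have T_mono: "T q \<subseteq> T p" if "p \<in> I" "q \<in> I" "le p q" for p q
    using that trans unfolding T_def by blast
  have in_J: "(T p, x p) \<in> J" if "p \<in> I" for p
    using that refl unfolding J_def T_def by blast
  have dir: "directed_set J leJ"
    unfolding directed_set_def
  proof (intro conjI)
    show "J \<noteq> {}" using I in_J unfolding directed_set_def by blast
    show "reflp_on J leJ" "transp_on J leJ"
      by (auto simp: reflp_on_def transp_on_def leJ_def)
    show "\<forall>r\<in>J. \<forall>s\<in>J. \<exists>t\<in>J. leJ r t \<and> leJ s t"
    proof (intro ballI)
      fix r s assume "r \<in> J" "s \<in> J"
      then obtain p q where pq: "p \<in> I" "q \<in> I" "fst r = T p" "fst s = T q"
        by (auto simp: J_def)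
      then obtain u where "u \<in> I" "le p u" "le q u"
        using I unfolding directed_set_def by blast
      then show "\<exists>t\<in>J. leJ r t \<and> leJ s t"
        using pq T_mono in_J by (intro bexI[of _ "(T u, x u)"]) (auto simp: leJ_def)
    qed
  qed
  have "tail_finer I le x J leJ snd"
    unfolding tail_finer_def
  proof
    fix p assume p: "p \<in> I"
    have "\<exists>\<alpha>\<in>I. le p \<alpha> \<and> x \<alpha> = snd r" if "r \<in> J" "leJ (T p, x p) r" for r
    proof -
      have "snd r \<in> T p" using that by (auto simp: J_def leJ_def)
      then show ?thesis by (auto simp: T_def)
    qed
    then show "\<exists>s\<in>J. \<forall>r\<in>J. leJ s r \<longrightarrow> (\<exists>\<alpha>\<in>I. le p \<alpha> \<and> x \<alpha> = snd r)"
      using in_J[OF p] by blast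
  qed
  then have "uo_Cauchy J leJ snd" by (rule uo_Cauchy_tail[OF C])
  then obtain l where l: "uo_converges J leJ snd l"
    using assms dir unfolding uo_complete_def uo_complete_over_def by blast
  have "tail_finer J leJ snd I le x"
    unfolding tail_finer_def
  proof
    fix r assume "r \<in> J"
    then obtain p where p: "p \<in> I" "fst r = T p" by (auto simp: J_def)
    have "\<exists>s\<in>J. leJ r s \<and> snd s = x q" if "q \<in> I" "le p q" for q
      using p that in_J T_mono by (intro bexI[of _ "(T q, x q)"]) (auto simp: leJ_def)
    then show "\<exists>p\<in>I. \<forall>q\<in>I. le p q \<longrightarrow> (\<exists>s\<in>J. leJ r s \<and> snd s = x q)"
      using p by blast
  qed
  from uo_converges_tail[OF l this] show "\<exists>l. uo_converges I le x l" by (rule exI)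
qed

end

theory Submission
  imports Defs
begin

text \<open>Let \<open>X\<close> be order complete. Suppose first that \<open>X\<close> is uo-complete, and let \<open>S\<close> be a
  disjoint set of positive vectors. The supremum of a finite disjoint set is its sum, so the net of finite partial sums, directed by
  inclusion, increases towards whatever supremum \<open>S\<close> may have. Truncated at a positive vector \<open>y\<close>, it is
  bounded by \<open>y\<close> and hence has a supremum \<open>z\<close>. The truncation of a disjoint sum is the sum of the
  truncations, so two partial sums beyond \<open>\<Sum>E\<close> differ, after truncation, by at most \<open>z - inf (\<Sum>E) y\<close>,
  and this decreases to \<open>0\<close> (\<open>uo_Cauchy_disjoint_sums\<close>). An increasing net that uo-converges has its
  limit as supremum (\<open>uo_limit_of_increasing_net\<close>), so \<open>S\<close> has a supremum.

  Conversely let \<open>X\<close> be universally complete. As \<open>x \<mapsto> pprt x\<close> is a contraction for the modulus, it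
  suffices to treat a uo-Cauchy net of positive vectors. Its limit can only be its limit inferior, that
  is, the supremum of the set \<open>D\<close> of positive vectors lying eventually below the net; if this supremum
  exists, every bound on \<open>inf \<bar>x \<alpha> - x \<beta>\<bar> y\<close> valid for all late \<open>\<alpha>, \<beta>\<close> is inherited by
  \<open>inf \<bar>x \<alpha> - l\<bar> y\<close> (\<open>nonneg_Cauchy_net_limit\<close>). The heart of the matter is that \<open>D\<close> is bounded above.

  In a representation of \<open>X\<close> by extended continuous functions, \<open>D\<close> fails to be bounded only if it
  is infinite on some nonempty open set, so that for some \<open>u > 0\<close> every multiple of \<open>u\<close> is a supremum of
  truncated elements of \<open>D\<close>. The lemma \<open>bdd_above_if_dominable\<close> is this dichotomy, proved without a
  representation: if no such \<open>u\<close> exists, then a maximal disjoint family of vectors on whose bands \<open>D\<close> is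
  bounded has a trivial disjoint complement, and lateral completeness glues the bounds on these bands
  together. For the Cauchy net such a \<open>u\<close> is impossible: elements of \<open>D\<close> reach up to every \<open>k u\<close>, while
  a single \<open>x \<beta>\<close> does not, so by the Archimedean property, in the form
  \<open>le_if_truncated_multiples_le\<close>, every Cauchy bound for distances truncated at \<open>u\<close> would be at least
  \<open>u\<close>.\<close>

section \<open>Inequalities in vector lattices\<close>

lemma isLub_UNIV_iff:
  fixes l :: "'a::order"
  shows "isLub UNIV S l \<longleftrightarrow> (\<forall>s\<in>S. s \<le> l) \<and> (\<forall>u. (\<forall>s\<in>S. s \<le> u) \<longrightarrow> l \<le> u)"
  by (auto simp: isLub_def leastP_def isUb_def setle_def setge_def)

lemma isGlb_UNIV_iff:
  fixes l :: "'a::order"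
  shows "isGlb UNIV S l \<longleftrightarrow> (\<forall>s\<in>S. l \<le> s) \<and> (\<forall>u. (\<forall>s\<in>S. u \<le> s) \<longrightarrow> u \<le> l)"
  by (auto simp: isGlb_def greatestP_def isLb_def setle_def setge_def)

text \<open>One half of the infinite distributive law. It holds because \<open>inf s y\<close> is \<open>s + y - sup s y\<close>, and
  \<open>sup s y\<close> is monotone in \<open>s\<close>.\<close>

lemma inf_isLub_le:
  fixes y :: "'a::lattice_ab_group_add"
  assumes l: "isLub UNIV S l" and S: "\<And>s. s \<in> S \<Longrightarrow> inf s y \<le> a"
  shows "inf l y \<le> a"
proof -
  have "s \<le> sup l y + a - y" if "s \<in> S" for s
  proof -
    have "s \<le> l" using l that by (auto simp: isLub_UNIV_iff)
    then have "sup s y + inf s y \<le> sup l y + a"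
      by (intro add_mono S that sup_mono order_refl)
    then show ?thesis by (simp add: add_eq_inf_sup[of s y, symmetric] le_diff_eq)
  qed
  then have "l \<le> sup l y + a - y" using l by (auto simp: isLub_UNIV_iff)
  then have "sup l y + inf l y \<le> sup l y + a"
    by (simp add: add_eq_inf_sup[of l y, symmetric] le_diff_eq)
  then show ?thesis by simp
qed

lemma inf_sup_leI:
  fixes y :: "'a::lattice_ab_group_add"
  assumes "inf s y \<le> a" "inf t y \<le> a"
  shows "inf (sup s t) y \<le> a"
  by (rule inf_isLub_le[of "{s, t}"]) (use assms in \<open>auto simp: isLub_UNIV_iff\<close>)

lemma inf_abs_leI:
  fixes y :: "'a::lattice_ab_group_add_abs"
  shows "inf d y \<le> a \<Longrightarrow> inf (- d) y \<le> a \<Longrightarrow> inf \<bar>d\<bar> y \<le> a"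
  unfolding abs_lattice by (rule inf_sup_leI)

lemma inf_add_le:
  fixes y :: "'a::lattice_ab_group_add"
  assumes "0 \<le> s" "0 \<le> t" "0 \<le> y"
  shows "inf (s + t) y \<le> inf s y + inf t y"
proof -
  have "inf (s + t) y \<le> s + y" "inf (s + t) y \<le> y + t" "inf (s + t) y \<le> y + y"
    using assms by (auto intro: le_infI2 simp: add_increasing add_increasing2)
  then show ?thesis
    by (simp add: add_sup_inf_distribs)
qed

lemma inf_scaleR_nat_eq_0:
  fixes v z :: "'a::vector_lattice"
  assumes "0 \<le> v" "0 \<le> z" "inf v z = 0"
  shows "inf (real k *\<^sub>R v) z = 0"
proof (induction k)
  case 0
  show ?case using assms by (simp add: inf_absorb1)
next
  case (Suc k)
  have "inf (v + real k *\<^sub>R v) z \<le> inf v z + inf (real k *\<^sub>R v) z"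
    using assms by (intro inf_add_le scaleR_nonneg_nonneg) auto
  then have "inf (real (Suc k) *\<^sub>R v) z \<le> inf v z + inf (real k *\<^sub>R v) z"
    by (simp add: scaleR_left_distrib)
  moreover have "0 \<le> inf (real (Suc k) *\<^sub>R v) z"
    using assms by (intro inf_greatest scaleR_nonneg_nonneg) auto
  ultimately show ?case using Suc assms by (simp add: order_antisym)
qed

lemma inf_pprt_pprt_minus:
  fixes c :: "'a::lattice_ab_group_add_abs"
  shows "inf (pprt c) (pprt (- c)) = 0"
proof (rule order_antisym)
  have "c \<le> \<bar>c\<bar>" "- c \<le> \<bar>c\<bar>" "0 \<le> \<bar>c\<bar>" by (auto simp: abs_ge_self abs_ge_minus_self)
  moreover have "\<bar>c\<bar> \<le> sup (pprt c) (pprt (- c))"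
    unfolding abs_lattice pprt_def by (auto intro: le_supI1 le_supI2)
  ultimately have "sup (pprt c) (pprt (- c)) = \<bar>c\<bar>"
    by (intro order_antisym) (auto simp: pprt_def)
  moreover have "pprt c + pprt (- c) = \<bar>c\<bar>"
    by (simp add: abs_prts pprt_neg)
  ultimately show "inf (pprt c) (pprt (- c)) \<le> 0"
    using add_eq_inf_sup[of "pprt c" "pprt (- c)"] by simp
qed simp

lemma abs_pprt_diff_le:
  fixes a b :: "'a::lattice_ab_group_add_abs"
  shows "\<bar>pprt a - pprt b\<bar> \<le> \<bar>a - b\<bar>"
proof -
  have *: "pprt c - pprt d \<le> \<bar>c - d\<bar>" for c d :: 'a
  proof -
    have "c - d \<le> \<bar>c - d\<bar>" by (rule abs_ge_self)
    then have "c \<le> \<bar>c - d\<bar> + d" by (simp add: diff_le_eq)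
    also have "\<dots> \<le> \<bar>c - d\<bar> + pprt d" by (simp add: pprt_def)
    finally have "pprt c \<le> \<bar>c - d\<bar> + pprt d" by (simp add: pprt_def add_increasing le_supI2)
    then show ?thesis by (simp add: diff_le_eq)
  qed
  show ?thesis using *[of a b] *[of b a] by (simp add: abs_le_iff abs_minus_commute)
qed

text \<open>In an Archimedean space the vectors \<open>inf (pprt (k t - s)) t\<close> increase to \<open>t\<close>: where \<open>k t\<close> exceeds \<open>s\<close>
  by at least \<open>t\<close> nothing is missing, and the defect, at most \<open>t\<close> and carried by the part where
  \<open>m t < s\<close> for \<open>m = k - 1\<close>, is therefore at most \<open>s / m\<close>.\<close>

lemma le_if_truncated_multiples_le:
  fixes t :: "'a::archimedean_vector_lattice"
  assumes t: "0 \<le> t" and s: "0 \<le> s" and w: "0 \<le> w"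
    and le: "\<And>k. inf (pprt (real k *\<^sub>R t - s)) t \<le> w"
  shows "t \<le> w"
proof -
  have "real m *\<^sub>R pprt (t - w) \<le> s" for m
  proof -
    define c where "c = s - real m *\<^sub>R t"
    \<comment> \<open>\<open>p\<close> bounds the defect; it is carried by the band of \<open>pprt c\<close>, where \<open>m t\<close> lies below \<open>s\<close>.\<close>
    define p where "p = inf (pprt c) t"
    have p0: "0 \<le> p" using t by (simp add: p_def)
    have "real (Suc m) *\<^sub>R t - s = t - c" by (simp add: c_def algebra_simps)
    then have "t - w \<le> t - inf (pprt (t - c)) t"
      using le[of "Suc m"] by (metis diff_left_mono)
    also have "\<dots> = pprt (inf c t)"
      by (simp add: pprt_def add_sup_inf_distribs)
    also have "\<dots> \<le> p"
      unfolding p_def pprt_def using t by (auto intro: le_infI1 le_supI1)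
    finally have tw: "pprt (t - w) \<le> p" using p0 by (simp add: pprt_def)
    have mp0: "0 \<le> real m *\<^sub>R p" using p0 by (simp add: scaleR_nonneg_nonneg)
    \<comment> \<open>Disjointness of \<open>p\<close> from \<open>pprt (- c)\<close> improves \<open>m p \<le> m t \<le> s + pprt (- c)\<close> to \<open>m p \<le> s\<close>.\<close>
    have "inf p (pprt (- c)) \<le> inf (pprt c) (pprt (- c))"
      by (auto simp: p_def intro: le_infI1)
    then have "inf p (pprt (- c)) = 0"
      using p0 by (simp add: inf_pprt_pprt_minus order_antisym)
    then have disj: "inf (real m *\<^sub>R p) (pprt (- c)) = 0"
      using p0 by (intro inf_scaleR_nat_eq_0) auto
    have "real m *\<^sub>R p \<le> real m *\<^sub>R t"
      by (intro scaleR_left_mono) (auto simp: p_def)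
    also have "\<dots> = s + (- c)" by (simp add: c_def)
    also have "\<dots> \<le> s + pprt (- c)" by (intro add_left_mono) (simp add: pprt_def)
    finally have "real m *\<^sub>R p = inf (s + pprt (- c)) (real m *\<^sub>R p)"
      by (simp add: inf_absorb2)
    also have "\<dots> \<le> inf s (real m *\<^sub>R p) + inf (pprt (- c)) (real m *\<^sub>R p)"
      using s mp0 by (intro inf_add_le) auto
    also have "\<dots> \<le> s" using disj by (simp add: inf_commute)
    finally have "real m *\<^sub>R p \<le> s" .
    moreover have "real m *\<^sub>R pprt (t - w) \<le> real m *\<^sub>R p"
      by (intro scaleR_left_mono tw) simp
    ultimately show ?thesis by (rule order_trans[rotated])
  qed
  then have "pprt (t - w) = 0" by (intro archimedean_vl[of _ s]) auto
  then show ?thesis by (simp flip: le_zero_iff_zero_pprt)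
qed


section \<open>Suprema and infima in order complete vector lattices\<close>

lemma order_complete_isLub:
  fixes S :: "'a::archimedean_vector_lattice set"
  assumes oc: "order_complete TYPE('a)" and S: "S \<noteq> {}" "bdd_above S"
  obtains l where "isLub UNIV S l"
proof -
  \<comment> \<open>Replacing \<open>S\<close> by its elements joined with a fixed one makes it bounded below as well and keeps
    its upper bounds.\<close>
  obtain b where b: "b \<in> S" using S by blast
  obtain M where M: "\<And>s. s \<in> S \<Longrightarrow> s \<le> M" using S by (auto simp: bdd_above_def)
  have above: "bdd_above (sup b ` S)"
    using M b by (intro bdd_aboveI[of _ M]) auto
  have below: "bdd_below (sup b ` S)" by (intro bdd_belowI[of _ b]) auto
  have "sup b ` S \<noteq> {}" using S by simp
  from oc[unfolded order_complete_def, rule_format, OF this above below]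
  obtain l where l: "isLub UNIV (sup b ` S) l" by (elim exE)
  have "s \<le> l" if "s \<in> S" for s
  proof -
    have "sup b s \<le> l" using l that by (auto simp: isLub_UNIV_iff)
    then show ?thesis by simp
  qed
  moreover have "l \<le> u" if "\<forall>s\<in>S. s \<le> u" for u
    using l b that by (auto simp: isLub_UNIV_iff)
  ultimately have "isLub UNIV S l" by (auto simp: isLub_UNIV_iff)
  then show thesis by (rule that)
qed

lemma isLub_image_diff:
  fixes S :: "'a::lattice_ab_group_add set"
  assumes "isGlb UNIV S g"
  shows "isLub UNIV ((\<lambda>s. c - s) ` S) (c - g)"
  unfolding isLub_UNIV_iff
proof (intro conjI ballI allI impI)
  fix u assume "\<forall>t\<in>(\<lambda>s. c - s) ` S. t \<le> u"
  then have "\<forall>s\<in>S. c - u \<le> s" by (simp add: diff_le_eq add.commute)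
  then have "c - u \<le> g" using assms by (simp add: isGlb_UNIV_iff)
  then show "c - g \<le> u" by (simp add: diff_le_eq add.commute)
qed (use assms in \<open>auto simp: isGlb_UNIV_iff diff_left_mono\<close>)

lemma order_complete_isGlb:
  fixes S :: "'a::archimedean_vector_lattice set"
  assumes oc: "order_complete TYPE('a)" and S: "S \<noteq> {}" "bdd_below S"
  obtains g where "isGlb UNIV S g"
proof -
  obtain m where m: "\<And>s. s \<in> S \<Longrightarrow> m \<le> s" using S by (auto simp: bdd_below_def)
  define L where "L = {c. \<forall>s\<in>S. c \<le> s}"
  obtain b where b: "b \<in> S" using S by blast
  have "L \<noteq> {}" using m by (auto simp: L_def)
  moreover have "bdd_above L" using b by (intro bdd_aboveI[of _ b]) (auto simp: L_def)
  ultimately obtain g where g: "isLub UNIV L g"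
    by (rule order_complete_isLub[OF oc])
  have "g \<le> s" if "s \<in> S" for s
    using g that by (auto simp: L_def isLub_UNIV_iff)
  moreover have "c \<le> g" if "\<forall>s\<in>S. c \<le> s" for c
    using g that by (auto simp: L_def isLub_UNIV_iff)
  ultimately have "isGlb UNIV S g" by (auto simp: isGlb_UNIV_iff)
  then show thesis by (rule that)
qed


section \<open>Uo-completeness implies lateral completeness\<close>

text \<open>Disjoint vectors satisfy \<open>a + b = sup a b\<close>, as \<open>a + b = sup a b + inf a b\<close>. The two claims are
  proved together because the induction step for the first needs that the new vector is disjoint from
  the sum of the old ones. The element \<open>0\<close> is inserted for the sake of the empty sum.\<close>

lemma disjoint_nonneg_sum:
  fixes F :: "'a::vector_lattice set"
  assumes "finite F" "pairwise vl_disjoint F" "\<And>s. s \<in> F \<Longrightarrow> 0 \<le> s"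
  shows "isLub UNIV (insert 0 F) (\<Sum>F)"
    and "\<And>b. 0 \<le> b \<Longrightarrow> (\<And>s. s \<in> F \<Longrightarrow> inf s b = 0) \<Longrightarrow> inf (\<Sum>F) b = 0"
proof -
  have "isLub UNIV (insert 0 F) (\<Sum>F) \<and>
      (\<forall>b\<ge>0. (\<forall>s\<in>F. inf s b = 0) \<longrightarrow> inf (\<Sum>F) b = 0)"
    using assms
  proof (induction F rule: finite_induct)
    case empty
    then show ?case by (simp add: isLub_UNIV_iff inf_absorb1)
  next
    case (insert a F)
    have F: "pairwise vl_disjoint F" "\<And>s. s \<in> F \<Longrightarrow> 0 \<le> s" and a: "0 \<le> a"
      using insert by (auto simp: pairwise_insert)
    note IH = insert.IH[OF F]
    have aF: "inf s a = 0" if "s \<in> F" for s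
    proof -
      have "vl_disjoint s a" using insert that by (auto simp: pairwise_insert)
      then show ?thesis using a F(2)[OF that] by (simp add: vl_disjoint_def)
    qed
    have S0: "0 \<le> \<Sum>F" using F by (simp add: sum_nonneg)
    have "inf (\<Sum>F) a = 0" using IH a aF by blast
    then have eq: "\<Sum>(insert a F) = sup a (\<Sum>F)"
      using insert by (simp add: add_eq_inf_sup[of a] inf_commute)
    have "isLub UNIV (insert 0 (insert a F)) (\<Sum>(insert a F))"
      using IH unfolding eq isLub_UNIV_iff by (auto intro: le_supI2)
    moreover have "inf (\<Sum>(insert a F)) b = 0"
      if "0 \<le> b" "\<forall>s\<in>insert a F. inf s b = 0" for b
    proof (rule order_antisym)
      show "inf (\<Sum>(insert a F)) b \<le> 0"
        unfolding eq using that IH by (intro inf_sup_leI) auto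
      show "0 \<le> inf (\<Sum>(insert a F)) b"
        unfolding eq using that a by (auto intro: le_supI1)
    qed
    ultimately show ?case by blast
  qed
  then show "isLub UNIV (insert 0 F) (\<Sum>F)"
    "\<And>b. 0 \<le> b \<Longrightarrow> (\<And>s. s \<in> F \<Longrightarrow> inf s b = 0) \<Longrightarrow> inf (\<Sum>F) b = 0"
    by blast+
qed

text \<open>The meet of the two truncations is below that of the disjoint sums, hence at most \<open>0\<close>, so the sum of
  the truncations is at most their supremum.\<close>

lemma truncated_disjoint_sums:
  fixes F G :: "'a::vector_lattice set"
  assumes fin: "finite F" "finite G" and FG: "F \<inter> G = {}"
    and disj: "pairwise vl_disjoint (F \<union> G)" and nonneg: "\<And>s. s \<in> F \<union> G \<Longrightarrow> 0 \<le> s"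
  shows "inf (\<Sum>F) y + inf (\<Sum>G) y \<le> inf (\<Sum>(F \<union> G)) y"
proof -
  have pF: "pairwise vl_disjoint F" and pG: "pairwise vl_disjoint G"
    using disj by (auto intro: pairwise_subset)
  have F0: "0 \<le> \<Sum>F" and G0: "0 \<le> \<Sum>G" using nonneg by (auto intro: sum_nonneg)
  have "inf (\<Sum>F) g = 0" if g: "g \<in> G" for g
  proof (rule disjoint_nonneg_sum(2)[OF fin(1) pF])
    fix s assume s: "s \<in> F"
    then have "s \<noteq> g" using g FG by blast
    then have "vl_disjoint s g" using disj s g by (auto simp: pairwise_def)
    then show "inf s g = 0" using nonneg s g by (simp add: vl_disjoint_def)
  qed (use g nonneg in auto)
  then have "inf (\<Sum>G) (\<Sum>F) = 0"
    using nonneg F0 by (intro disjoint_nonneg_sum(2)[OF fin(2) pG]) (auto simp: inf_commute)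
  moreover have "inf (inf (\<Sum>F) y) (inf (\<Sum>G) y) \<le> inf (\<Sum>G) (\<Sum>F)"
    by (simp add: le_infI1 le_infI2)
  ultimately have "inf (inf (\<Sum>F) y) (inf (\<Sum>G) y) \<le> 0" by simp
  then have "inf (\<Sum>F) y + inf (\<Sum>G) y \<le> sup (inf (\<Sum>F) y) (inf (\<Sum>G) y)"
    by (subst add_eq_inf_sup) simp
  also have "\<dots> \<le> inf (\<Sum>(F \<union> G)) y"
    using F0 G0 FG fin
    by (simp add: sum.union_disjoint le_infI1 add_increasing add_increasing2)
  finally show ?thesis .
qed

text \<open>If some \<open>x \<alpha>0\<close> were not below \<open>l\<close>, then \<open>pprt (x \<alpha>0 - l)\<close> would stay below \<open>\<bar>x \<alpha> - l\<bar>\<close> for all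
  later \<open>\<alpha>\<close>; if \<open>l\<close> were not below an upper bound \<open>u\<close>, then \<open>pprt (l - u)\<close> would. Truncating at such a
  vector shows that it vanishes.\<close>

lemma uo_limit_of_increasing_net:
  fixes x :: "'i \<Rightarrow> 'a::vector_lattice"
  assumes I: "directed_set I le" and mono: "\<And>\<alpha> \<beta>. \<alpha> \<in> I \<Longrightarrow> \<beta> \<in> I \<Longrightarrow> le \<alpha> \<beta> \<Longrightarrow> x \<alpha> \<le> x \<beta>"
    and lim: "uo_converges I le x l"
  shows "isLub UNIV (x ` I) l"
proof -
  have small: "y \<le> 0" if y: "0 \<le> y" and \<alpha>0: "\<alpha>0 \<in> I"
    and le: "\<And>\<alpha>. \<alpha> \<in> I \<Longrightarrow> le \<alpha>0 \<alpha> \<Longrightarrow> y \<le> \<bar>x \<alpha> - l\<bar>" for y \<alpha>0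
  proof -
    have "order_converges I le (\<lambda>\<alpha>. inf \<bar>x \<alpha> - l\<bar> y) 0"
      using lim y by (auto simp: uo_converges_def)
    then obtain J :: "'a set" and leJ a where a: "decreases_to_zero J leJ a"
      and dom: "order_dominated I le (\<lambda>\<alpha>. inf \<bar>x \<alpha> - l\<bar> y) 0 J a"
      by (auto simp: order_converges_def)
    have "y \<le> a \<gamma>" if \<gamma>: "\<gamma> \<in> J" for \<gamma>
    proof -
      obtain \<beta> where \<beta>: "\<beta> \<in> I" "\<forall>\<alpha>\<in>I. le \<beta> \<alpha> \<longrightarrow> \<bar>inf \<bar>x \<alpha> - l\<bar> y - 0\<bar> \<le> a \<gamma>"
        using dom \<gamma> unfolding order_dominated_def by blast
      obtain \<alpha> where \<alpha>: "\<alpha> \<in> I" "le \<alpha>0 \<alpha>" "le \<beta> \<alpha>"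
        using I \<alpha>0 \<beta>(1) by (auto simp: directed_set_def)
      have "inf \<bar>x \<alpha> - l\<bar> y = y" using le \<alpha> by (simp add: inf_absorb2)
      then show ?thesis using \<beta>(2) \<alpha> y by force
    qed
    then show ?thesis using a by (auto simp: decreases_to_zero_def isGlb_UNIV_iff)
  qed
  have "x \<alpha>0 \<le> l" if "\<alpha>0 \<in> I" for \<alpha>0
  proof -
    have "pprt (x \<alpha>0 - l) \<le> 0"
    proof (rule small[OF _ that])
      fix \<alpha> assume "\<alpha> \<in> I" "le \<alpha>0 \<alpha>"
      then have "x \<alpha>0 - l \<le> x \<alpha> - l" using mono that by (simp add: diff_right_mono)
      also have "\<dots> \<le> \<bar>x \<alpha> - l\<bar>" by (rule abs_ge_self)
      finally show "pprt (x \<alpha>0 - l) \<le> \<bar>x \<alpha> - l\<bar>" by (simp add: pprt_def)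
    qed simp
    then show ?thesis by (simp add: pprt_def)
  qed
  moreover have "l \<le> u" if u: "\<And>\<alpha>. \<alpha> \<in> I \<Longrightarrow> x \<alpha> \<le> u" for u
  proof -
    obtain \<alpha>0 where \<alpha>0: "\<alpha>0 \<in> I" using I by (auto simp: directed_set_def)
    have "pprt (l - u) \<le> 0"
    proof (rule small[OF _ \<alpha>0])
      fix \<alpha> assume "\<alpha> \<in> I"
      then have "l - u \<le> - (x \<alpha> - l)" using u by (simp add: diff_left_mono)
      also have "\<dots> \<le> \<bar>x \<alpha> - l\<bar>" by (rule abs_ge_minus_self)
      finally show "pprt (l - u) \<le> \<bar>x \<alpha> - l\<bar>" by (simp add: pprt_def)
    qed simp
    then show ?thesis by (simp add: pprt_def)
  qed
  ultimately show ?thesis by (auto simp: isLub_UNIV_iff)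
qed

lemma directed_finite_subsets: "directed_set {F. finite F \<and> F \<subseteq> S} (\<subseteq>)"
  unfolding directed_set_def
proof (intro conjI ballI)
  fix F G assume "F \<in> {F. finite F \<and> F \<subseteq> S}" "G \<in> {F. finite F \<and> F \<subseteq> S}"
  then show "\<exists>H\<in>{F. finite F \<and> F \<subseteq> S}. F \<subseteq> H \<and> G \<subseteq> H" by (intro bexI[of _ "F \<union> G"]) auto
qed (auto simp: reflp_on_def transp_on_def)

text \<open>Beyond a finite set \<open>E\<close> the partial sums differ by at most the sum over some finite \<open>H - E\<close>. Truncated
  at \<open>y\<close>, this sum fits into the gap between \<open>inf (\<Sum>E) y\<close> and the supremum of all such truncations.\<close>

lemma uo_Cauchy_disjoint_sums:
  fixes S :: "'a::archimedean_vector_lattice set"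
  assumes oc: "order_complete TYPE('a)"
    and nonneg: "\<And>s. s \<in> S \<Longrightarrow> 0 \<le> s" and disj: "pairwise vl_disjoint S"
  shows "uo_Cauchy {F. finite F \<and> F \<subseteq> S} (\<subseteq>) \<Sum>"
  unfolding uo_Cauchy_def uo_converges_def
proof (intro allI impI)
  fix y :: 'a assume y: "0 \<le> y"
  define I where "I = {F. finite F \<and> F \<subseteq> S}"
  have mono: "\<Sum>F \<le> \<Sum>G" if "F \<subseteq> G" "G \<in> I" for F G
    using that nonneg by (intro sum_mono2) (auto simp: I_def)
  have "(\<lambda>F. inf (\<Sum>F) y) ` I \<noteq> {}" by (auto simp: I_def)
  moreover have "bdd_above ((\<lambda>F. inf (\<Sum>F) y) ` I)" by (intro bdd_aboveI[of _ y]) auto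
  ultimately obtain z where z: "isLub UNIV ((\<lambda>F. inf (\<Sum>F) y) ` I) z"
    by (rule order_complete_isLub[OF oc])
  have bound: "inf \<bar>\<Sum>F - \<Sum>G\<bar> y \<le> z - inf (\<Sum>E) y"
    if EFG: "E \<in> I" "F \<in> I" "G \<in> I" "E \<subseteq> F" "E \<subseteq> G" for E F G
  proof -
    define H where "H = F \<union> G"
    have H: "H \<in> I" "finite H" "E \<subseteq> H" "F \<subseteq> H" "G \<subseteq> H" "H \<subseteq> S"
      using EFG by (auto simp: H_def I_def)
    have "\<Sum>F - \<Sum>G \<le> \<Sum>H - \<Sum>E" "\<Sum>G - \<Sum>F \<le> \<Sum>H - \<Sum>E"
      using mono EFG H by (auto intro!: diff_mono)
    then have "\<bar>\<Sum>F - \<Sum>G\<bar> \<le> \<Sum>H - \<Sum>E" by (simp add: abs_le_iff)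
    also have "\<dots> = \<Sum>(H - E)" using H by (simp add: sum_diff)
    finally have "inf \<bar>\<Sum>F - \<Sum>G\<bar> y \<le> inf (\<Sum>(H - E)) y" by (intro inf_mono order_refl)
    moreover have "inf (\<Sum>(H - E)) y + inf (\<Sum>E) y \<le> inf (\<Sum>((H - E) \<union> E)) y"
      using H nonneg by (intro truncated_disjoint_sums pairwise_subset[OF disj])
        (auto intro: finite_subset)
    moreover have "(H - E) \<union> E = H" using H by blast
    moreover have "inf (\<Sum>H) y \<le> z" using z H by (auto simp: isLub_UNIV_iff)
    ultimately have "inf \<bar>\<Sum>F - \<Sum>G\<bar> y + inf (\<Sum>E) y \<le> z"
      by (metis add_right_mono order_trans)
    then show ?thesis by (simp only: le_diff_eq)
  qed
  have "order_converges (I \<times> I) (rel_prod (\<subseteq>) (\<subseteq>))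
      (\<lambda>p. inf \<bar>(case p of (F, G) \<Rightarrow> \<Sum>F - \<Sum>G) - 0\<bar> y) 0"
  proof (rule order_convergesI)
    show "directed_set I (\<subseteq>)" unfolding I_def by (rule directed_finite_subsets)
    show "decreases_to_zero I (\<subseteq>) (\<lambda>F. z - inf (\<Sum>F) y)"
      unfolding decreases_to_zero_def isGlb_UNIV_iff
    proof (intro conjI ballI impI allI)
      fix F G assume "F \<in> I" "G \<in> I" "F \<subseteq> G"
      then show "z - inf (\<Sum>G) y \<le> z - inf (\<Sum>F) y"
        using mono by (intro diff_left_mono inf_mono) auto
    next
      fix s assume "s \<in> (\<lambda>F. z - inf (\<Sum>F) y) ` I"
      then show "0 \<le> s" using z by (auto simp: isLub_UNIV_iff simp del: diff_inf_eq_sup)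
    next
      fix u assume u: "\<forall>s\<in>(\<lambda>F. z - inf (\<Sum>F) y) ` I. u \<le> s"
      have "inf (\<Sum>F) y \<le> z - u" if "F \<in> I" for F
      proof -
        have "u \<le> z - inf (\<Sum>F) y" using u that by blast
        then show ?thesis by (metis add.commute le_diff_eq)
      qed
      then have "z \<le> z - u" using z by (auto simp: isLub_UNIV_iff)
      then show "u \<le> 0" by simp
    qed
    show "order_dominated (I \<times> I) (rel_prod (\<subseteq>) (\<subseteq>))
        (\<lambda>p. inf \<bar>(case p of (F, G) \<Rightarrow> \<Sum>F - \<Sum>G) - 0\<bar> y) 0 I (\<lambda>F. z - inf (\<Sum>F) y)"
      unfolding order_dominated_def
    proof
      fix E assume E: "E \<in> I"
      show "\<exists>p0\<in>I \<times> I. \<forall>p\<in>I \<times> I. rel_prod (\<subseteq>) (\<subseteq>) p0 p \<longrightarrow>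
          \<bar>inf \<bar>(case p of (F, G) \<Rightarrow> \<Sum>F - \<Sum>G) - 0\<bar> y - 0\<bar> \<le> z - inf (\<Sum>E) y"
      proof (rule bexI[of _ "(E, E)"], clarify)
        fix F G assume "F \<in> I" "G \<in> I" "rel_prod (\<subseteq>) (\<subseteq>) (E, E) (F, G)"
        then show "\<bar>inf \<bar>\<Sum>F - \<Sum>G - 0\<bar> y - 0\<bar> \<le> z - inf (\<Sum>E) y"
          using bound[OF E, of F G] y by (simp del: diff_inf_eq_sup)
      qed (use E in auto)
    qed
  qed
  then show "order_converges ({F. finite F \<and> F \<subseteq> S} \<times> {F. finite F \<and> F \<subseteq> S})
      (rel_prod (\<subseteq>) (\<subseteq>)) (\<lambda>p. inf \<bar>(case p of (F, G) \<Rightarrow> \<Sum>F - \<Sum>G) - 0\<bar> y) 0"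
    by (simp add: I_def)
qed

lemma uo_complete_imp_laterally_complete:
  assumes oc: "order_complete TYPE('a::archimedean_vector_lattice)"
    and uo: "uo_complete TYPE('a)"
  shows "laterally_complete TYPE('a)"
  unfolding laterally_complete_def
proof (intro allI impI)
  fix S :: "'a set"
  assume ne: "S \<noteq> {}" and nonneg: "\<forall>s\<in>S. 0 \<le> s" and disj: "pairwise vl_disjoint S"
  define I where "I = {F. finite F \<and> F \<subseteq> S}"
  have I: "directed_set I (\<subseteq>)" unfolding I_def by (rule directed_finite_subsets)
  have "uo_Cauchy I (\<subseteq>) \<Sum>"
    unfolding I_def using nonneg by (intro uo_Cauchy_disjoint_sums oc disj) auto
  then obtain l where "uo_converges I (\<subseteq>) \<Sum> l"
    using uo_complete_over_any[OF uo] I unfolding uo_complete_over_def by blast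
  then have l: "isLub UNIV (\<Sum> ` I) l"
    using nonneg by (intro uo_limit_of_increasing_net[OF I]) (auto simp: I_def intro!: sum_mono2)
  have "isLub UNIV S l"
    unfolding isLub_UNIV_iff
  proof (intro conjI ballI allI impI)
    fix s assume "s \<in> S"
    then have "{s} \<in> I" by (auto simp: I_def)
    then have "\<Sum>{s} \<le> l" using l unfolding isLub_UNIV_iff by blast
    then show "s \<le> l" by simp
  next
    fix u assume u: "\<forall>s\<in>S. s \<le> u"
    then have "0 \<le> u" using ne nonneg by (meson ex_in_conv order_trans)
    have "\<Sum>F \<le> u" if "F \<in> I" for F
    proof -
      have "isLub UNIV (insert 0 F) (\<Sum>F)"
        using that nonneg by (intro disjoint_nonneg_sum(1) pairwise_subset[OF disj]) (auto simp: I_def)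
      then show ?thesis using u \<open>0 \<le> u\<close> that unfolding isLub_UNIV_iff I_def by blast
    qed
    then show "l \<le> u" using l by (auto simp: isLub_UNIV_iff)
  qed
  then show "\<exists>s. isLub UNIV S s" ..
qed


section \<open>Boundedness criterion in universally complete vector lattices\<close>

text \<open>The assumption on \<open>u\<close> says that some multiple \<open>k u\<close> exceeds every \<open>a \<in> D\<close> on the support of a common
  \<open>w > 0\<close>; on the band of \<open>w\<close> all of \<open>D\<close> then lies below \<open>k u\<close>. Order completeness alone cannot produce a
  global bound from these local ones. Lateral completeness does, since the least bounds on disjoint bands
  are disjoint vectors.\<close>

lemma bdd_above_if_dominable:
  fixes D :: "'a::archimedean_vector_lattice set"
  assumes oc: "order_complete TYPE('a)" and lc: "laterally_complete TYPE('a)"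
    and D: "D \<noteq> {}" "\<And>a. a \<in> D \<Longrightarrow> 0 \<le> a"
    and dominable: "\<And>u. 0 < u \<Longrightarrow> \<exists>w k. 0 < w \<and> (\<forall>a\<in>D. w \<le> pprt (real k *\<^sub>R u - a))"
  shows "bdd_above D"
proof -
  \<comment> \<open>The truncations in \<open>E v\<close> stand in for the projections of \<open>D\<close> to the band of \<open>v\<close>.\<close>
  define E where "E v = {inf a (real k *\<^sub>R v) |a k. a \<in> D}" for v
  define \<V> where "\<V> = {V. pairwise vl_disjoint V \<and> (\<forall>v\<in>V. 0 < v \<and> bdd_above (E v))}"
  have "\<Union>\<C> \<in> \<V>" if "\<C> \<in> chains \<V>" for \<C>
    using that unfolding \<V>_def chains_def by (auto intro!: pairwise_chain_Union)
  then obtain V where V: "V \<in> \<V>" and max: "\<And>W. W \<in> \<V> \<Longrightarrow> V \<subseteq> W \<Longrightarrow> W = V"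
    using Zorn_Lemma[of \<V>] by blast
  have V0: "0 < v" and VE: "bdd_above (E v)" if "v \<in> V" for v
    using V that by (auto simp: \<V>_def)
  have E_nonneg: "0 \<le> e" if "e \<in> E v" "v \<in> V" for e v
    using that D V0[of v] by (auto simp: E_def intro!: scaleR_nonneg_nonneg)
  have E_ne: "E v \<noteq> {}" for v using D by (auto simp: E_def)
  define b where "b v = (SOME l. isLub UNIV (E v) l)" for v
  have b: "isLub UNIV (E v) (b v)" if "v \<in> V" for v
    unfolding b_def by (rule order_complete_isLub[OF oc E_ne VE[OF that]]) (rule someI)
  have b0: "0 \<le> b v" if "v \<in> V" for v
    using b[OF that] E_ne[of v] E_nonneg[OF _ that] unfolding isLub_UNIV_iff
    by (meson ex_in_conv order_trans)
  have b_disj: "inf (b v) (b v') = 0" if v: "v \<in> V" "v' \<in> V" "v \<noteq> v'" for v v'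
  proof (rule order_antisym)
    have nn: "0 \<le> v" "0 \<le> v'" using V0 v by (auto intro: less_imp_le)
    have "vl_disjoint v v'" using V v unfolding \<V>_def pairwise_def by blast
    then have vv: "inf v v' = 0" using nn by (simp add: vl_disjoint_def)
    have "inf e e' \<le> 0" if "e \<in> E v" "e' \<in> E v'" for e e'
    proof -
      obtain k where "e \<le> real k *\<^sub>R v" using \<open>e \<in> E v\<close> unfolding E_def by (blast intro: inf_le2)
      moreover obtain k' where "e' \<le> real k' *\<^sub>R v'"
        using \<open>e' \<in> E v'\<close> unfolding E_def by (blast intro: inf_le2)
      ultimately have "inf e e' \<le> inf (real k *\<^sub>R v) (real k' *\<^sub>R v')" by (rule inf_mono)
      also have "\<dots> = 0"
        using inf_scaleR_nat_eq_0[OF nn(1) _ inf_scaleR_nat_eq_0[OF nn(2,1), THEN trans[OF inf_commute]]]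
          nn vv by (simp add: inf_commute scaleR_nonneg_nonneg)
      finally show ?thesis .
    qed
    then have "inf (b v) e' \<le> 0" if "e' \<in> E v'" for e'
      using that by (intro inf_isLub_le[OF b[OF v(1)]]) auto
    then have "inf (b v') (b v) \<le> 0"
      by (intro inf_isLub_le[OF b[OF v(2)]]) (simp add: inf_commute)
    then show "inf (b v) (b v') \<le> 0" by (simp add: inf_commute)
    show "0 \<le> inf (b v) (b v')" using b0 v by simp
  qed
  \<comment> \<open>\<open>V\<close> may be empty; inserting \<open>0\<close> makes lateral completeness applicable.\<close>
  have disj: "pairwise vl_disjoint (insert 0 (b ` V))"
    unfolding pairwise_def
  proof (intro ballI impI)
    fix c d assume cd: "c \<in> insert 0 (b ` V)" "d \<in> insert 0 (b ` V)" "c \<noteq> d"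
    then consider "c = 0" | "d = 0" | v v' where "v \<in> V" "v' \<in> V" "c = b v" "d = b v'" by blast
    then show "vl_disjoint c d"
    proof cases
      case (3 v v')
      then have "inf c d = 0" using cd b_disj[of v v'] by auto
      then show ?thesis using 3 b0 by (simp add: vl_disjoint_def)
    qed (simp_all add: vl_disjoint_def inf_absorb1 inf_absorb2)
  qed
  have "\<exists>s. isLub UNIV (insert 0 (b ` V)) s"
    using b0 by (intro lc[unfolded laterally_complete_def, rule_format] disj) auto
  then obtain s where s: "isLub UNIV (insert 0 (b ` V)) s" ..
  have s0: "0 \<le> s" and bs: "\<And>v. v \<in> V \<Longrightarrow> b v \<le> s" using s by (auto simp: isLub_UNIV_iff)
  have Es: "e \<le> s" if "e \<in> E v" "v \<in> V" for e v
    using b[OF that(2)] bs[OF that(2)] that(1) unfolding isLub_UNIV_iff by (meson order_trans)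
  have "a \<le> s" if a: "a \<in> D" for a
  proof (rule ccontr)
    assume "\<not> a \<le> s"
    define u where "u = pprt (a - s)"
    have "u \<noteq> 0" using \<open>\<not> a \<le> s\<close> by (simp add: u_def flip: le_zero_iff_zero_pprt)
    then have u: "0 < u" by (simp add: u_def order_less_le)
    \<comment> \<open>On the band of \<open>v\<close> the vector \<open>a\<close> is already below \<open>s\<close>, so the excess \<open>u\<close> lives off it. Then a good
      \<open>w\<close> below a multiple of \<open>u\<close> contradicts the maximality of \<open>V\<close>.\<close>
    have uv: "inf u v = 0" if v: "v \<in> V" for v
    proof (rule order_antisym)
      have v0: "0 \<le> v" using V0[OF v] by simp
      show "inf u v \<le> 0"
      proof (rule le_if_truncated_multiples_le[OF _ s0])
        fix k
        have "inf a (real k *\<^sub>R v) \<le> s" using a by (intro Es[OF _ v]) (auto simp: E_def)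
        moreover have "inf (a - s) (real k *\<^sub>R v - s) = inf a (real k *\<^sub>R v) - s"
          using add_inf_distrib_right[of a "real k *\<^sub>R v" "- s"] by simp
        ultimately have "inf (a - s) (real k *\<^sub>R v - s) \<le> 0" by simp
        then have "inf u (real k *\<^sub>R v - s) \<le> 0"
          unfolding u_def pprt_def by (intro inf_sup_leI) auto
        then have "inf (pprt (real k *\<^sub>R v - s)) u \<le> 0"
          unfolding pprt_def by (intro inf_sup_leI) (auto simp: inf_commute)
        moreover have "inf (pprt (real k *\<^sub>R inf u v - s)) (inf u v) \<le> inf (pprt (real k *\<^sub>R v - s)) u"
          by (intro inf_mono pprt_mono diff_right_mono scaleR_left_mono) auto
        ultimately show "inf (pprt (real k *\<^sub>R inf u v - s)) (inf u v) \<le> 0" by (rule order_trans[rotated])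
      qed (use u v0 in auto)
      show "0 \<le> inf u v" using u v0 by simp
    qed
    obtain w k where w: "0 < w" "\<And>a. a \<in> D \<Longrightarrow> w \<le> pprt (real k *\<^sub>R u - a)"
      using dominable[OF u] by blast
    have w0: "0 \<le> w" using w(1) by simp
    have ku0: "0 \<le> real k *\<^sub>R u" using u by (simp add: scaleR_nonneg_nonneg)
    have "w \<le> pprt (real k *\<^sub>R u - a)" using w a by blast
    also have "\<dots> \<le> real k *\<^sub>R u" using D(2)[OF a] ku0 by (simp add: pprt_def)
    finally have wku: "w \<le> real k *\<^sub>R u" .
    have wv: "inf w v = 0" if v: "v \<in> V" for v
    proof (rule order_antisym)
      have "inf (real k *\<^sub>R u) v = 0" using u V0[OF v] uv[OF v] by (intro inf_scaleR_nat_eq_0) auto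
      then show "inf w v \<le> 0" using inf_mono[OF wku order_refl[of v]] by simp
      show "0 \<le> inf w v" using w0 V0[OF v] by (simp add: less_imp_le)
    qed
    have "e \<le> real k *\<^sub>R u" if "e \<in> E w" for e
    proof -
      obtain d j where d: "d \<in> D" and e: "e = inf d (real j *\<^sub>R w)" using \<open>e \<in> E w\<close> by (auto simp: E_def)
      define c where "c = pprt (d - real k *\<^sub>R u)"
      have jw0: "0 \<le> real j *\<^sub>R w" using w0 by (simp add: scaleR_nonneg_nonneg)
      have "inf w c \<le> inf (pprt (real k *\<^sub>R u - d)) (pprt (- (real k *\<^sub>R u - d)))"
        unfolding c_def using w(2)[OF d] by (intro inf_mono) auto
      also have "\<dots> = 0" by (rule inf_pprt_pprt_minus)
      finally have "inf w c = 0" using w0 by (intro order_antisym) (auto simp: c_def)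
      then have "inf (real j *\<^sub>R w) c = 0" using w0 by (intro inf_scaleR_nat_eq_0) (auto simp: c_def)
      moreover have "d \<le> c + real k *\<^sub>R u"
        unfolding c_def pprt_def by (simp add: add_sup_distrib_right)
      then have "e \<le> inf (c + real k *\<^sub>R u) (real j *\<^sub>R w)" unfolding e by (intro inf_mono) auto
      then have "e \<le> inf c (real j *\<^sub>R w) + inf (real k *\<^sub>R u) (real j *\<^sub>R w)"
        using ku0 jw0 by (elim order_trans, intro inf_add_le) (auto simp: c_def)
      ultimately show ?thesis by (simp add: inf_commute)
    qed
    then have "bdd_above (E w)" by (intro bdd_aboveI)
    moreover have "pairwise vl_disjoint (insert w V)"
      using V wv w0 V0 by (auto simp: \<V>_def pairwise_insert vl_disjoint_def inf_commute less_imp_le)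
    ultimately have "insert w V \<in> \<V>" using V w(1) by (auto simp: \<V>_def)
    then have "w \<in> V" using max by blast
    then show False using wv[of w] w(1) by simp
  qed
  then show ?thesis by (intro bdd_aboveI)
qed


section \<open>Limits of uo-Cauchy nets\<close>

text \<open>Some tail of the net has diameter at most \<open>a\<close> when distances are truncated at \<open>y\<close>. Stating limits
  through such bounds lets one index set of dominating vectors serve several nets at once.\<close>

definition cauchy_bound ::
    "'i set \<Rightarrow> ('i \<Rightarrow> 'i \<Rightarrow> bool) \<Rightarrow> ('i \<Rightarrow> 'a::vector_lattice) \<Rightarrow> 'a \<Rightarrow> 'a \<Rightarrow> bool" where
  "cauchy_bound I le x y a \<longleftrightarrow>
     (\<exists>\<alpha>0\<in>I. \<forall>\<alpha>\<in>I. \<forall>\<beta>\<in>I. le \<alpha>0 \<alpha> \<longrightarrow> le \<alpha>0 \<beta> \<longrightarrow> inf \<bar>x \<alpha> - x \<beta>\<bar> y \<le> a)"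

lemma cauchy_bound_mono:
  assumes "\<And>\<alpha> \<beta>. \<bar>x' \<alpha> - x' \<beta>\<bar> \<le> \<bar>x \<alpha> - x \<beta>\<bar>" "cauchy_bound I le x y a"
  shows "cauchy_bound I le x' y a"
proof -
  have "inf \<bar>x' \<alpha> - x' \<beta>\<bar> y \<le> a" if "inf \<bar>x \<alpha> - x \<beta>\<bar> y \<le> a" for \<alpha> \<beta>
    using inf_mono[OF assms(1) order_refl] that by (rule order_trans)
  then show ?thesis using assms(2) unfolding cauchy_bound_def by blast
qed

lemma uo_Cauchy_bounds:
  fixes x :: "'i \<Rightarrow> 'a::vector_lattice"
  assumes I: "directed_set I le" and C: "uo_Cauchy I le x" and y: "0 \<le> y"
  shows "\<exists>(J::'a set) leJ a. directed_set J leJ \<and> decreases_to_zero J leJ a \<and>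
    (\<forall>\<gamma>\<in>J. cauchy_bound I le x y (a \<gamma>))"
proof -
  have "order_converges (I \<times> I) (rel_prod le le)
      (\<lambda>p. inf \<bar>(case p of (\<alpha>, \<beta>) \<Rightarrow> x \<alpha> - x \<beta>) - 0\<bar> y) 0"
    using C y unfolding uo_Cauchy_def uo_converges_def by blast
  then obtain J :: "'a set" and leJ a where J: "directed_set J leJ" "decreases_to_zero J leJ a"
    and dom: "order_dominated (I \<times> I) (rel_prod le le)
      (\<lambda>p. inf \<bar>(case p of (\<alpha>, \<beta>) \<Rightarrow> x \<alpha> - x \<beta>) - 0\<bar> y) 0 J a"
    unfolding order_converges_def by blast
  have "cauchy_bound I le x y (a \<gamma>)" if \<gamma>: "\<gamma> \<in> J" for \<gamma>
  proof -
    obtain p q where pq: "p \<in> I" "q \<in> I"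
      and le: "\<And>\<alpha> \<beta>. \<alpha> \<in> I \<Longrightarrow> \<beta> \<in> I \<Longrightarrow> le p \<alpha> \<Longrightarrow> le q \<beta> \<Longrightarrow> \<bar>inf \<bar>x \<alpha> - x \<beta>\<bar> y\<bar> \<le> a \<gamma>"
      using dom \<gamma> unfolding order_dominated_def by fastforce
    obtain r where r: "r \<in> I" "le p r" "le q r" using I pq unfolding directed_set_def by blast
    have "inf \<bar>x \<alpha> - x \<beta>\<bar> y \<le> a \<gamma>" if "\<alpha> \<in> I" "\<beta> \<in> I" "le r \<alpha>" "le r \<beta>" for \<alpha> \<beta>
    proof -
      have "le p \<alpha>" "le q \<beta>" using I pq r that unfolding directed_set_def transp_on_def by blast+
      then show ?thesis using le[of \<alpha> \<beta>] that y by simp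
    qed
    then show ?thesis using r(1) unfolding cauchy_bound_def by blast
  qed
  then show ?thesis using J by blast
qed

text \<open>The assumption on \<open>u\<close> is what remains of the uo-Cauchy condition: no nonzero positive vector lies below all
  Cauchy bounds at its own level. It excludes that \<open>D\<close> is infinite on the band of \<open>u\<close>. The limit does not
  depend on \<open>y\<close> or \<open>a\<close>, and it keeps the very bound \<open>a\<close>: from above, because the infimum of a tail belongs to
  \<open>D\<close> and each member of the tail is, after truncation, within \<open>a\<close> of the others; from below, because each \<open>d \<in> D\<close> is
  eventually dominated by members of the tail.\<close>

lemma nonneg_Cauchy_net_limit:
  fixes x :: "'i \<Rightarrow> 'a::archimedean_vector_lattice"
  assumes oc: "order_complete TYPE('a)" and lc: "laterally_complete TYPE('a)"
    and I: "directed_set I le" and x0: "\<And>\<alpha>. \<alpha> \<in> I \<Longrightarrow> 0 \<le> x \<alpha>"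
    and Cauchy: "\<And>u. 0 \<le> u \<Longrightarrow> (\<And>a. cauchy_bound I le x u a \<Longrightarrow> u \<le> a) \<Longrightarrow> u = 0"
  shows "\<exists>l. \<forall>y a. cauchy_bound I le x y a \<longrightarrow>
    (\<exists>\<alpha>0\<in>I. \<forall>\<alpha>\<in>I. le \<alpha>0 \<alpha> \<longrightarrow> inf \<bar>x \<alpha> - l\<bar> y \<le> a)"
proof -
  have refl: "le \<alpha> \<alpha>" if "\<alpha> \<in> I" for \<alpha>
    using I that by (auto simp: directed_set_def reflp_on_def)
  have dir: "\<exists>\<gamma>\<in>I. le \<alpha> \<gamma> \<and> le \<beta> \<gamma>" if "\<alpha> \<in> I" "\<beta> \<in> I" for \<alpha> \<beta>
    using I that by (auto simp: directed_set_def)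
  define D where "D = {d. 0 \<le> d \<and> (\<exists>\<alpha>0\<in>I. \<forall>\<alpha>\<in>I. le \<alpha>0 \<alpha> \<longrightarrow> d \<le> x \<alpha>)}"
  have D_ne: "D \<noteq> {}" using I x0 by (auto simp: D_def directed_set_def intro!: exI[of _ 0])
  have D_diff: "inf (d - x \<beta>) y \<le> a"
    if d: "d \<in> D" and \<alpha>0: "\<alpha>0 \<in> I"
      and b: "\<And>\<alpha> \<beta>. \<alpha> \<in> I \<Longrightarrow> \<beta> \<in> I \<Longrightarrow> le \<alpha>0 \<alpha> \<Longrightarrow> le \<alpha>0 \<beta> \<Longrightarrow> inf \<bar>x \<alpha> - x \<beta>\<bar> y \<le> a"
      and \<beta>: "\<beta> \<in> I" "le \<alpha>0 \<beta>" for d \<alpha>0 \<beta> y a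
  proof -
    obtain \<alpha>1 where \<alpha>1: "\<alpha>1 \<in> I" "\<And>\<alpha>. \<alpha> \<in> I \<Longrightarrow> le \<alpha>1 \<alpha> \<Longrightarrow> d \<le> x \<alpha>" using d by (auto simp: D_def)
    obtain \<alpha> where \<alpha>: "\<alpha> \<in> I" "le \<alpha>0 \<alpha>" "le \<alpha>1 \<alpha>" using dir[OF \<alpha>0 \<alpha>1(1)] by blast
    have "d - x \<beta> \<le> x \<alpha> - x \<beta>" using \<alpha>1(2) \<alpha> by (simp add: diff_right_mono)
    also have "\<dots> \<le> \<bar>x \<alpha> - x \<beta>\<bar>" by (rule abs_ge_self)
    finally have "inf (d - x \<beta>) y \<le> inf \<bar>x \<alpha> - x \<beta>\<bar> y" by (intro inf_mono order_refl)
    also have "\<dots> \<le> a" using b \<alpha> \<beta> by blast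
    finally show ?thesis .
  qed
  have "bdd_above D"
  proof (rule bdd_above_if_dominable[OF oc lc D_ne])
    fix u :: 'a assume u: "0 < u"
    \<comment> \<open>Otherwise \<open>0\<close> is the infimum of \<open>pprt (k u - d)\<close> over \<open>d \<in> D\<close>, for every \<open>k\<close>, and every Cauchy bound at
      level \<open>u\<close> is at least \<open>u\<close>.\<close>
    show "\<exists>w k. 0 < w \<and> (\<forall>d\<in>D. w \<le> pprt (real k *\<^sub>R u - d))"
    proof (rule ccontr)
      assume contr: "\<not> ?thesis"
      have "u \<le> a" if a: "cauchy_bound I le x u a" for a
      proof -
        obtain \<beta> where \<beta>: "\<beta> \<in> I"
          and b: "\<And>\<alpha> \<alpha>'. \<alpha> \<in> I \<Longrightarrow> \<alpha>' \<in> I \<Longrightarrow> le \<beta> \<alpha> \<Longrightarrow> le \<beta> \<alpha>' \<Longrightarrow> inf \<bar>x \<alpha> - x \<alpha>'\<bar> u \<le> a"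
          using a unfolding cauchy_bound_def by blast
        have "inf \<bar>x \<beta> - x \<beta>\<bar> u \<le> a" by (rule b[OF \<beta> \<beta> refl refl]) (use \<beta> in auto)
        then have a0: "0 \<le> a" using u by (simp add: inf_absorb1)
        show ?thesis
        proof (rule le_if_truncated_multiples_le[OF _ x0[OF \<beta>] a0])
          fix k
          \<comment> \<open>Truncated at \<open>u\<close>, the excess of \<open>k u\<close> over \<open>x \<beta>\<close> is at most that of \<open>d\<close> over \<open>x \<beta>\<close>, itself at
            most \<open>a\<close>, plus \<open>pprt (k u - d)\<close>, which has infimum \<open>0\<close>.\<close>
          define g where "g = inf (pprt (real k *\<^sub>R u - x \<beta>)) u"
          have "g - a \<le> pprt (real k *\<^sub>R u - d)" if d: "d \<in> D" for d
          proof -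
            have "inf (d - x \<beta>) u \<le> a" by (rule D_diff[OF d \<beta> b \<beta> refl[OF \<beta>]])
            then have da: "inf (pprt (d - x \<beta>)) u \<le> a"
              unfolding pprt_def using a0 u by (intro inf_sup_leI) (auto simp: inf_absorb1)
            have "real k *\<^sub>R u - x \<beta> = (real k *\<^sub>R u - d) + (d - x \<beta>)" by simp
            also have "\<dots> \<le> pprt (real k *\<^sub>R u - d) + pprt (d - x \<beta>)"
              by (intro add_mono) (auto simp: pprt_def)
            finally have "pprt (real k *\<^sub>R u - x \<beta>) \<le> pprt (real k *\<^sub>R u - d) + pprt (d - x \<beta>)"
              by (simp add: pprt_def[of "real k *\<^sub>R u - x \<beta>"])
            then have "g \<le> inf (pprt (real k *\<^sub>R u - d) + pprt (d - x \<beta>)) u"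
              unfolding g_def by (intro inf_mono order_refl)
            also have "\<dots> \<le> inf (pprt (real k *\<^sub>R u - d)) u + inf (pprt (d - x \<beta>)) u"
              using u by (intro inf_add_le) auto
            also have "\<dots> \<le> pprt (real k *\<^sub>R u - d) + a" using da by (intro add_mono) auto
            finally show ?thesis by (simp add: diff_le_eq)
          qed
          then have "pprt (g - a) \<le> pprt (real k *\<^sub>R u - d)" if "d \<in> D" for d
            using that by (simp add: pprt_def[of "g - a"])
          then have "\<not> 0 < pprt (g - a)" using contr by blast
          then have "pprt (g - a) = 0" by (simp add: order_less_le)
          then show "g \<le> a" by (simp flip: le_zero_iff_zero_pprt)
        qed (use u in auto)
      qed
      then have "u = 0" using u by (intro Cauchy) auto
      then show False using u by simp
    qed
  qed (auto simp: D_def)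
  then obtain l where l: "isLub UNIV D l" by (rule order_complete_isLub[OF oc D_ne])
  have "\<exists>\<alpha>0\<in>I. \<forall>\<alpha>\<in>I. le \<alpha>0 \<alpha> \<longrightarrow> inf \<bar>x \<alpha> - l\<bar> y \<le> a"
    if a: "cauchy_bound I le x y a" for y a
  proof -
    obtain \<alpha>0 where \<alpha>0: "\<alpha>0 \<in> I"
      and b: "\<And>\<alpha> \<beta>. \<alpha> \<in> I \<Longrightarrow> \<beta> \<in> I \<Longrightarrow> le \<alpha>0 \<alpha> \<Longrightarrow> le \<alpha>0 \<beta> \<Longrightarrow> inf \<bar>x \<alpha> - x \<beta>\<bar> y \<le> a"
      using a unfolding cauchy_bound_def by blast
    define T where "T = x ` {\<beta>\<in>I. le \<alpha>0 \<beta>}"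
    have "T \<noteq> {}" using \<alpha>0 refl by (auto simp: T_def)
    moreover have "bdd_below T" using x0 by (intro bdd_belowI[of _ 0]) (auto simp: T_def)
    ultimately obtain m where m: "isGlb UNIV T m"
      by (rule order_complete_isGlb[OF oc])
    have "0 \<le> m" using m x0 by (auto simp: T_def isGlb_UNIV_iff)
    moreover have "\<forall>\<alpha>\<in>I. le \<alpha>0 \<alpha> \<longrightarrow> m \<le> x \<alpha>" using m by (auto simp: T_def isGlb_UNIV_iff)
    ultimately have "m \<in> D" using \<alpha>0 by (auto simp: D_def)
    then have ml: "m \<le> l" using l by (auto simp: isLub_UNIV_iff)
    have "inf \<bar>x \<alpha> - l\<bar> y \<le> a" if \<alpha>: "\<alpha> \<in> I" "le \<alpha>0 \<alpha>" for \<alpha>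
    proof (rule inf_abs_leI)
      have "inf (x \<alpha> - m) y \<le> a"
      proof (rule inf_isLub_le[OF isLub_image_diff[OF m]])
        fix s assume "s \<in> (\<lambda>s. x \<alpha> - s) ` T"
        then obtain \<beta> where \<beta>: "\<beta> \<in> I" "le \<alpha>0 \<beta>" "s = x \<alpha> - x \<beta>" by (auto simp: T_def)
        have "inf s y \<le> inf \<bar>x \<alpha> - x \<beta>\<bar> y" using \<beta> by (intro inf_mono) (auto simp: abs_ge_self)
        then show "inf s y \<le> a" using b[OF \<alpha>(1) \<beta>(1) \<alpha>(2) \<beta>(2)] by (rule order_trans)
      qed
      moreover have "inf (x \<alpha> - l) y \<le> inf (x \<alpha> - m) y" using ml by (intro inf_mono diff_left_mono) auto
      ultimately show "inf (x \<alpha> - l) y \<le> a" by (rule order_trans[rotated])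
      have "isLub UNIV ((\<lambda>d. d - x \<alpha>) ` D) (l - x \<alpha>)"
        using l unfolding isLub_UNIV_iff by (auto simp: diff_le_eq)
      then have "inf (l - x \<alpha>) y \<le> a"
        by (rule inf_isLub_le) (auto intro: D_diff[OF _ \<alpha>0 b \<alpha>])
      then show "inf (- (x \<alpha> - l)) y \<le> a" by simp
    qed
    then show ?thesis using \<alpha>0 by blast
  qed
  then show ?thesis by blast
qed

lemma decreases_to_zero_double:
  fixes a :: "'j \<Rightarrow> 'a::vector_lattice"
  assumes "decreases_to_zero J le a"
  shows "decreases_to_zero J le (\<lambda>\<gamma>. a \<gamma> + a \<gamma>)"
  unfolding decreases_to_zero_def isGlb_UNIV_iff
proof (intro conjI ballI impI allI)
  fix u assume u: "\<forall>s\<in>(\<lambda>\<gamma>. a \<gamma> + a \<gamma>) ` J. u \<le> s"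
  have "(1/2) *\<^sub>R u \<le> a \<gamma>" if "\<gamma> \<in> J" for \<gamma>
  proof -
    have "(1/2) *\<^sub>R u \<le> (1/2) *\<^sub>R (a \<gamma> + a \<gamma>)" using u that by (intro scaleR_left_mono) auto
    then show ?thesis by (simp flip: scaleR_2)
  qed
  then have "(1/2) *\<^sub>R u \<le> 0" using assms by (auto simp: decreases_to_zero_def isGlb_UNIV_iff)
  then have "2 *\<^sub>R (1/2) *\<^sub>R u \<le> 2 *\<^sub>R 0" by (intro scaleR_left_mono) auto
  then show "u \<le> 0" by simp
qed (use assms in \<open>auto simp: decreases_to_zero_def isGlb_UNIV_iff add_mono\<close>)

text \<open>The positive and negative parts inherit every Cauchy bound \<open>a\<close> of the net, so the net stays within
  \<open>a + a\<close> of the difference of their limits.\<close>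

lemma universally_complete_imp_uo_complete_over:
  assumes oc: "order_complete TYPE('a::archimedean_vector_lattice)"
    and lc: "laterally_complete TYPE('a)"
  shows "uo_complete_over TYPE('i) TYPE('a)"
  unfolding uo_complete_over_def
proof (intro allI impI)
  fix I :: "'i set" and le and x :: "'i \<Rightarrow> 'a"
  assume I: "directed_set I le" and C: "uo_Cauchy I le x"
  have limit: "\<exists>l. \<forall>y a. cauchy_bound I le x' y a \<longrightarrow>
      (\<exists>\<alpha>0\<in>I. \<forall>\<alpha>\<in>I. le \<alpha>0 \<alpha> \<longrightarrow> inf \<bar>x' \<alpha> - l\<bar> y \<le> a)"
    if x': "\<And>\<alpha>. 0 \<le> x' \<alpha>" "\<And>\<alpha> \<beta>. \<bar>x' \<alpha> - x' \<beta>\<bar> \<le> \<bar>x \<alpha> - x \<beta>\<bar>" for x'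
  proof (rule nonneg_Cauchy_net_limit[OF oc lc I x'(1)])
    fix u :: 'a assume u: "0 \<le> u" and le: "\<And>a. cauchy_bound I le x' u a \<Longrightarrow> u \<le> a"
    obtain J :: "'a set" and leJ a where a: "decreases_to_zero J leJ a"
      and b: "\<And>\<gamma>. \<gamma> \<in> J \<Longrightarrow> cauchy_bound I le x u (a \<gamma>)"
      using uo_Cauchy_bounds[OF I C u] by blast
    have "u \<le> a \<gamma>" if "\<gamma> \<in> J" for \<gamma>
      using le cauchy_bound_mono[OF x'(2) b[OF that]] by blast
    then have "u \<le> 0" using a by (auto simp: decreases_to_zero_def isGlb_UNIV_iff)
    then show "u = 0" using u by simp
  qed
  have pos: "\<bar>pprt (x \<alpha>) - pprt (x \<beta>)\<bar> \<le> \<bar>x \<alpha> - x \<beta>\<bar>" for \<alpha> \<beta> by (rule abs_pprt_diff_le)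
  have neg: "\<bar>pprt (- x \<alpha>) - pprt (- x \<beta>)\<bar> \<le> \<bar>x \<alpha> - x \<beta>\<bar>" for \<alpha> \<beta>
    using abs_pprt_diff_le[of "- x \<alpha>" "- x \<beta>"] by (simp add: abs_minus_commute)
  obtain l where l: "\<And>y a. cauchy_bound I le (\<lambda>\<alpha>. pprt (x \<alpha>)) y a \<Longrightarrow>
      \<exists>\<alpha>0\<in>I. \<forall>\<alpha>\<in>I. le \<alpha>0 \<alpha> \<longrightarrow> inf \<bar>pprt (x \<alpha>) - l\<bar> y \<le> a"
    using limit[of "\<lambda>\<alpha>. pprt (x \<alpha>)", OF zero_le_pprt pos] by meson
  obtain m where m: "\<And>y a. cauchy_bound I le (\<lambda>\<alpha>. pprt (- x \<alpha>)) y a \<Longrightarrow>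
      \<exists>\<alpha>0\<in>I. \<forall>\<alpha>\<in>I. le \<alpha>0 \<alpha> \<longrightarrow> inf \<bar>pprt (- x \<alpha>) - m\<bar> y \<le> a"
    using limit[of "\<lambda>\<alpha>. pprt (- x \<alpha>)", OF zero_le_pprt neg] by meson
  have "uo_converges I le x (l - m)"
    unfolding uo_converges_def
  proof (intro allI impI)
    fix y :: 'a assume y: "0 \<le> y"
    obtain J :: "'a set" and leJ a where J: "directed_set J leJ" and a: "decreases_to_zero J leJ a"
      and b: "\<And>\<gamma>. \<gamma> \<in> J \<Longrightarrow> cauchy_bound I le x y (a \<gamma>)"
      using uo_Cauchy_bounds[OF I C y] by blast
    show "order_converges I le (\<lambda>\<alpha>. inf \<bar>x \<alpha> - (l - m)\<bar> y) 0"
    proof (rule order_convergesI[OF J decreases_to_zero_double[OF a]])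
      show "order_dominated I le (\<lambda>\<alpha>. inf \<bar>x \<alpha> - (l - m)\<bar> y) 0 J (\<lambda>\<gamma>. a \<gamma> + a \<gamma>)"
        unfolding order_dominated_def
      proof
        fix \<gamma> assume \<gamma>: "\<gamma> \<in> J"
        obtain p where p: "p \<in> I" "\<And>\<alpha>. \<alpha> \<in> I \<Longrightarrow> le p \<alpha> \<Longrightarrow> inf \<bar>pprt (x \<alpha>) - l\<bar> y \<le> a \<gamma>"
          using l[OF cauchy_bound_mono[OF pos b[OF \<gamma>]]] by blast
        obtain q where q: "q \<in> I" "\<And>\<alpha>. \<alpha> \<in> I \<Longrightarrow> le q \<alpha> \<Longrightarrow> inf \<bar>pprt (- x \<alpha>) - m\<bar> y \<le> a \<gamma>"
          using m[OF cauchy_bound_mono[OF neg b[OF \<gamma>]]] by blast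
        obtain r where r: "r \<in> I" "le p r" "le q r"
          using I p(1) q(1) unfolding directed_set_def by blast
        have "\<bar>inf \<bar>x \<alpha> - (l - m)\<bar> y - 0\<bar> \<le> a \<gamma> + a \<gamma>" if \<alpha>: "\<alpha> \<in> I" "le r \<alpha>" for \<alpha>
        proof -
          have le: "le p \<alpha>" "le q \<alpha>"
            using I p(1) q(1) r \<alpha> unfolding directed_set_def transp_on_def by blast+
          have "x \<alpha> = pprt (x \<alpha>) - pprt (- x \<alpha>)" by (simp add: pprt_neg flip: prts)
          then have "x \<alpha> - (l - m) = (pprt (x \<alpha>) - l) - (pprt (- x \<alpha>) - m)"
            by (metis diff_diff_eq2 diff_add_eq diff_diff_add add.commute)
          then have "\<bar>x \<alpha> - (l - m)\<bar> \<le> \<bar>pprt (x \<alpha>) - l\<bar> + \<bar>pprt (- x \<alpha>) - m\<bar>"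
            by (metis abs_triangle_ineq4)
          then have "inf \<bar>x \<alpha> - (l - m)\<bar> y \<le> inf (\<bar>pprt (x \<alpha>) - l\<bar> + \<bar>pprt (- x \<alpha>) - m\<bar>) y"
            by (intro inf_mono order_refl)
          also have "\<dots> \<le> inf \<bar>pprt (x \<alpha>) - l\<bar> y + inf \<bar>pprt (- x \<alpha>) - m\<bar> y"
            using y by (intro inf_add_le) auto
          also have "\<dots> \<le> a \<gamma> + a \<gamma>" using p(2) q(2) \<alpha> le by (intro add_mono) auto
          finally show ?thesis using y by simp
        qed
        then show "\<exists>\<alpha>0\<in>I. \<forall>\<alpha>\<in>I. le \<alpha>0 \<alpha> \<longrightarrow> \<bar>inf \<bar>x \<alpha> - (l - m)\<bar> y - 0\<bar> \<le> a \<gamma> + a \<gamma>"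
          using r(1) by blast
      qed
    qed
  qed
  then show "\<exists>l. uo_converges I le x l" ..
qed


section \<open>Uo-completeness and universal completeness\<close>

theorem proposition2p8:
  assumes "order_complete TYPE('a::archimedean_vector_lattice)"
  shows "(uo_complete TYPE('a) \<longrightarrow> universally_complete TYPE('a)) \<and>
         (universally_complete TYPE('a) \<and> countable_sup_property TYPE('a) \<longrightarrow> uo_complete TYPE('a))"
  using assms uo_complete_imp_laterally_complete[where 'a = 'a]
    universally_complete_imp_uo_complete_over[where 'a = 'a]
  unfolding universally_complete_def uo_complete_def by blast

end
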